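(* Let $n\ge2$, let $\mathbf A=(A,q,\mathsf e_1,\dots,\mathsf e_n)$ be an $n\mathrm{BA}$, and fix $i\ne j$ in $\{1,\dots,n\}$. Let $\phi$ be a congruence on $\mathbf A$ and $H=(H_1,\dots,H_n)$ be a multideal of $\mathbf A$. Then $$\theta_{I(\phi)}=\phi\quad\text{and}\quad I(\theta_H)=H.$$
   Context: Let $n\ge 2$. An $n\mathrm{BA}$ (Boolean-like algebra of dimension $n$) is an algebra $\mathbf A=(A,q,\mathsf e_1,\dots,\mathsf e_n)$ with $q$ of arity $n+1$ and constants $\mathsf e_1,\dots,\mathsf e_n$ satisfying the identities (B0) $q(\mathsf e_i,x^1,\dots,x^n)=x^i$ for $i=1,\dots,n$; (B1) $q(y,x,\dots,x)=x$; (B2) $q(y,q(y,x^{11},\dots,x^{1n}),\dots,q(y,x^{n1},\dots,x^{nn}))=q(y,x^{11},x^{22},\dots,x^{nn})$; (B3) $q(y,q(x^{10},\dots,x^{1n}),\dots,q(x^{n0},\dots,x^{nn}))=q(q(y,x^{10},\dots,x^{n0}),\dots,q(y,x^{1n},\dots,x^{nn}))$; (B4) $q(y,\mathsf e_1,\dots,\mathsf e_n)=y$. For $k\in\{1,\dots,n\}$ let $t_k(x,y,z)=q(x,w_1,\dots,w_n)$ with $w_k=z$ and $w_m=y$ for $m\ne k$; $x\land_i y=t_i(x,y,\mathsf e_i)$; $x\,\overline\vee_i\,y=t_i(x,x,y)$; $x\le^i y$ iff $x\land_i y=x=y\land_i x$. A multideal of $\mathbf A$ is a tuple $(I_1,\dots,I_n)$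 of pairwise disjoint subsets of $A$ such that: (m1) $\mathsf e_k\in I_k$ for all $k$; (m2) if $a\in I_r$, $b\in I_k$ and $y_1,\dots,y_n\in A$, then $q(a,y_1,\dots,y_{r-1},b,y_{r+1},\dots,y_n)\in I_k$; (m3) if $a\in A$ and $y_1,\dots,y_n\in I_k$, then $q(a,y_1,\dots,y_n)\in I_k$. By convention the constant tuple $(A,\dots,A)$ is also allowed, as a degenerate multideal. For a congruence $\phi$, $I(\phi)=(\mathsf e_1/\phi,\dots,\mathsf e_n/\phi)$; it is a multideal when $\phi\ne A\times A$, and it is the degenerate multideal $(A,\dots,A)$ when $\phi=A\times A$. Fix $i\ne j$. The Boolean center $B_{ij}=\{x\in A: x\le^i\mathsf e_j\}$ is a Boolean algebra with meet $\land_i$, join $\overline\vee_i$, complement $\neg_{ij}(x)=t_i(x,\mathsf e_i,\mathsf e_j)$, bottom $\mathsf e_i$ and top $\mathsf e_j$. The coordinates of $x\in A$ are $x_k=t_k(x,\mathsf e_i,\mathsf e_j)\in B_{ij}$, $1\le k\le n$. For a (possibly degenerate) multideal $I$, $I_*=B_{ij}\cap I_i$ is a Boolean ideal of $B_{ij}$; let $f_I:B_{ij}\to B_{ij}/I_*$ be the quotient homomorphism, and define $x\,\theta_I\,y$ iff $f_I(x_k)=f_I(y_k)$ for all $1\le k\le n$. *)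

theory Defs
  imports "HOL-Library.Cardinality"
begin

text \<open>
  The index set \<open>{1,\<dots>,n}\<close> is a finite type \<open>'n\<close> with \<open>n = CARD('n)\<close>, so that an operation of
  arity \<open>n + 1\<close> on \<open>A\<close> is a function \<open>'a \<Rightarrow> ('n \<Rightarrow> 'a) \<Rightarrow> 'a\<close> and an \<open>n\<close>-tuple of subsets of \<open>A\<close> is a
  function \<open>'n \<Rightarrow> 'a set\<close>. The axioms only constrain \<open>q\<close> on arguments from the carrier \<open>A\<close>.
\<close>

locale nBA =
  fixes A :: "'a set"
    and q :: "'a \<Rightarrow> ('n::finite \<Rightarrow> 'a) \<Rightarrow> 'a"
    and e :: "'n \<Rightarrow> 'a"
  assumes dim: "CARD('n) \<ge> 2"
    and q_closed: "\<And>y x. y \<in> A \<Longrightarrow> (\<And>k. x k \<in> A) \<Longrightarrow> q y x \<in> A"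
    and e_closed: "\<And>k. e k \<in> A"
    and B0: "\<And>k x. (\<And>m. x m \<in> A) \<Longrightarrow> q (e k) x = x k"
    and B1: "\<And>y x. y \<in> A \<Longrightarrow> x \<in> A \<Longrightarrow> q y (\<lambda>_. x) = x"
    and B2: "\<And>y x. y \<in> A \<Longrightarrow> (\<And>k m. x k m \<in> A) \<Longrightarrow> q y (\<lambda>k. q y (x k)) = q y (\<lambda>k. x k k)"
    and B3: "\<And>y x0 x. y \<in> A \<Longrightarrow> (\<And>k. x0 k \<in> A) \<Longrightarrow> (\<And>k m. x k m \<in> A) \<Longrightarrow>
               q y (\<lambda>k. q (x0 k) (x k)) = q (q y x0) (\<lambda>m. q y (\<lambda>k. x k m))"
    and B4: "\<And>y. y \<in> A \<Longrightarrow> q y e = y"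
begin

definition t :: "'n \<Rightarrow> 'a \<Rightarrow> 'a \<Rightarrow> 'a \<Rightarrow> 'a" where
  "t k x y z = q x (\<lambda>m. if m = k then z else y)"

definition meet :: "'n \<Rightarrow> 'a \<Rightarrow> 'a \<Rightarrow> 'a" where
  "meet i x y = t i x y (e i)"

definition join :: "'n \<Rightarrow> 'a \<Rightarrow> 'a \<Rightarrow> 'a" where
  "join i x y = t i x x y"

definition leq :: "'n \<Rightarrow> 'a \<Rightarrow> 'a \<Rightarrow> bool" where
  "leq i x y \<longleftrightarrow> meet i x y = x \<and> meet i y x = x"

definition congruence :: "('a \<times> 'a) set \<Rightarrow> bool" where
  "congruence \<phi> \<longleftrightarrow> equiv A \<phi> \<and>
     (\<forall>x x' y y'. (x, x') \<in> \<phi> \<longrightarrow> (\<forall>k. (y k, y' k) \<in> \<phi>) \<longrightarrow> (q x y, q x' y') \<in> \<phi>)"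

definition proper_multideal :: "('n \<Rightarrow> 'a set) \<Rightarrow> bool" where
  "proper_multideal I \<longleftrightarrow>
     (\<forall>k. I k \<subseteq> A) \<and>
     (\<forall>k m. k \<noteq> m \<longrightarrow> I k \<inter> I m = {}) \<and>
     (\<forall>k. e k \<in> I k) \<and>
     (\<forall>r k a b y. a \<in> I r \<longrightarrow> b \<in> I k \<longrightarrow> (\<forall>m. y m \<in> A) \<longrightarrow> q a (y(r := b)) \<in> I k) \<and>
     (\<forall>k a y. a \<in> A \<longrightarrow> (\<forall>m. y m \<in> I k) \<longrightarrow> q a y \<in> I k)"

text \<open>Multideals include the degenerate one \<open>(A,\<dots>,A)\<close>.\<close>

definition multideal :: "('n \<Rightarrow> 'a set) \<Rightarrow> bool" where
  "multideal I \<longleftrightarrow> proper_multideal I \<or> I = (\<lambda>_. A)"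

definition cong_multideal :: "('a \<times> 'a) set \<Rightarrow> 'n \<Rightarrow> 'a set" where
  "cong_multideal \<phi> = (\<lambda>k. \<phi> `` {e k})"

definition B :: "'n \<Rightarrow> 'n \<Rightarrow> 'a set" where
  "B i j = {x \<in> A. leq i x (e j)}"

definition neg :: "'n \<Rightarrow> 'n \<Rightarrow> 'a \<Rightarrow> 'a" where
  "neg i j x = t i x (e i) (e j)"

definition coord :: "'n \<Rightarrow> 'n \<Rightarrow> 'n \<Rightarrow> 'a \<Rightarrow> 'a" where
  "coord i j k x = t k x (e i) (e j)"

text \<open>The Boolean ideal \<open>I\<^sub>*\<close> of \<open>B i j\<close> associated with \<open>I\<close>.\<close>

definition bideal :: "'n \<Rightarrow> 'n \<Rightarrow> ('n \<Rightarrow> 'a set) \<Rightarrow> 'a set" where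
  "bideal i j I = B i j \<inter> I i"

text \<open>
  The quotient of the Boolean algebra \<open>B i j\<close> by a Boolean ideal \<open>J\<close> is its quotient by the
  relation \<open>bideal_rel i j J\<close>, which identifies \<open>x\<close> and \<open>y\<close> when their symmetric difference
  lies in \<open>J\<close>.
\<close>

definition symdiff :: "'n \<Rightarrow> 'n \<Rightarrow> 'a \<Rightarrow> 'a \<Rightarrow> 'a" where
  "symdiff i j x y = join i (meet i x (neg i j y)) (meet i (neg i j x) y)"

definition bideal_rel :: "'n \<Rightarrow> 'n \<Rightarrow> 'a set \<Rightarrow> ('a \<times> 'a) set" where
  "bideal_rel i j J = {(x, y). x \<in> B i j \<and> y \<in> B i j \<and> symdiff i j x y \<in> J}"

definition quot_hom :: "'n \<Rightarrow> 'n \<Rightarrow> ('n \<Rightarrow> 'a set) \<Rightarrow> 'a \<Rightarrow> 'a set" where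
  "quot_hom i j I x = bideal_rel i j (bideal i j I) `` {x}"

definition theta :: "'n \<Rightarrow> 'n \<Rightarrow> ('n \<Rightarrow> 'a set) \<Rightarrow> ('a \<times> 'a) set" where
  "theta i j I = {(x, y). x \<in> A \<and> y \<in> A \<and>
     (\<forall>k. quot_hom i j I (coord i j k x) = quot_hom i j I (coord i j k y))}"

end

end

(* Each a in A acts on tuples as a decomposition operator, so a should be thought of as a function
   into {1,...,n} and q(a, s) as selecting s_k on the part where a is k. By B1 and B3,
   q(q(a, w), s) = q(a, q(w_1, s), ..., q(w_n, s)), and with B2 this rewrites the symmetric
   difference as x + y = t_i(x, neg y, y), on which everything is computed.
   For theta_{I(phi)} = phi, x + y phi e_i gives x = (x + y) + y phi e_i + y = y on the Boolean
   center, and x is rebuilt from its coordinates by nested applications of q.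
   For I(theta_H) = H, if a is in H_k then b = t_k(a, e_j, e_i) is in H_i, whence q(a, s) lies in
   H_r iff s_k does, as s_k = t_i(b, s_k, q(a, s)); conversely a = t_i(b, a, e_k) lies in H_k
   as soon as b lies in H_i. *)

theory Submission
  imports Defs
begin

context nBA
begin

section \<open>Calculus of \<open>q\<close> and \<open>t\<close>\<close>

lemma t_closed:
  assumes "x \<in> A" "y \<in> A" "z \<in> A"
  shows "t k x y z \<in> A"
  unfolding t_def using assms by (intro q_closed) auto

lemma t_e:
  assumes "y \<in> A" "z \<in> A"
  shows "t k (e l) y z = (if l = k then z else y)"
  unfolding t_def using assms by (subst B0) auto

text \<open>This is \<open>B3\<close> with the same tuple \<open>u\<close> in every row: each column
  is then constant and collapses by \<open>B1\<close>.\<close>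

lemma q_q:
  assumes "x \<in> A" "\<And>k. w k \<in> A" "\<And>k. u k \<in> A"
  shows "q (q x w) u = q x (\<lambda>k. q (w k) u)"
proof -
  have "q x (\<lambda>k. q (w k) u) = q (q x w) (\<lambda>m. q x (\<lambda>k. u m))"
    using assms by (intro B3)
  then show ?thesis using assms by (simp add: B1)
qed

lemma t_q:
  assumes "x \<in> A" "\<And>k. w k \<in> A" "y \<in> A" "z \<in> A"
  shows "t m (q x w) y z = q x (\<lambda>k. t m (w k) y z)"
  unfolding t_def using assms by (intro q_q) auto

text \<open>An instance of \<open>B2\<close>: with row \<open>m\<close> equal to \<open>u\<close>
  and every other row equal to \<open>v\<close>, the diagonal follows \<open>u\<close> where
  \<open>x\<close> is \<open>m\<close> and \<open>v\<close> elsewhere.\<close>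

lemma t_diag:
  assumes "x \<in> A" "\<And>k. u k \<in> A" "\<And>k. v k \<in> A"
  shows "t m x (q x v) (q x u) = q x (\<lambda>k. if k = m then u k else v k)"
proof -
  have "t m x (q x v) (q x u) = q x (\<lambda>k. q x (if k = m then u else v))"
    unfolding t_def by (rule arg_cong[of _ _ "q x"]) auto
  also have "\<dots> = q x (\<lambda>k. (if k = m then u else v) k)"
    using assms by (intro B2) auto
  also have "\<dots> = q x (\<lambda>k. if k = m then u k else v k)"
    by (rule arg_cong[of _ _ "q x"]) auto
  finally show ?thesis .
qed

lemma t_t:
  assumes "x \<in> A" "a \<in> A" "b \<in> A" "y \<in> A" "z \<in> A"
  shows "t m (t k x a b) y z = t k x (t m a y z) (t m b y z)"
proof -
  have "t m (t k x a b) y z = q x (\<lambda>l. t m (if l = k then b else a) y z)"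
    unfolding t_def[of k] using assms by (intro t_q) auto
  also have "\<dots> = t k x (t m a y z) (t m b y z)"
    unfolding t_def[of k] by (rule arg_cong[of _ _ "q x"]) auto
  finally show ?thesis .
qed

text \<open>The branch \<open>w\<close> would be taken only where \<open>x\<close> is
  \<open>m\<close>, and there the outer \<open>t\<close> has already chosen
  \<open>z\<close>.\<close>

lemma t_diag_fst:
  assumes "x \<in> A" "v \<in> A" "w \<in> A" "z \<in> A"
  shows "t m x (t m x v w) z = t m x v z"
proof -
  have "t m x (q x (\<lambda>k. if k = m then w else v)) (q x (\<lambda>_. z))
      = q x (\<lambda>k. if k = m then z else if k = m then w else v)"
    using assms by (intro t_diag) auto
  also have "\<dots> = t m x v z"
    unfolding t_def by (rule arg_cong[of _ _ "q x"]) auto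
  finally show ?thesis using assms by (simp add: B1 t_def)
qed

lemma t_diag_snd:
  assumes "x \<in> A" "v \<in> A" "w \<in> A" "y \<in> A"
  shows "t m x y (t m x v w) = t m x y w"
proof -
  have "t m x (q x (\<lambda>_. y)) (q x (\<lambda>k. if k = m then w else v))
      = q x (\<lambda>k. if k = m then if k = m then w else v else y)"
    using assms by (intro t_diag) auto
  also have "\<dots> = t m x y w"
    unfolding t_def by (rule arg_cong[of _ _ "q x"]) auto
  finally show ?thesis using assms by (simp add: B1 t_def)
qed

lemma t_const:
  assumes "x \<in> A" "y \<in> A"
  shows "t m x y y = y"
  using assms by (simp add: t_def B1)

text \<open>Write \<open>x\<close> as \<open>q x e\<close> by \<open>B4\<close>; the entry that gets
  overwritten is already \<open>e m\<close>.\<close>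

lemma t_self:
  assumes "x \<in> A"
  shows "t m x x (e m) = x"
proof -
  have "t m x (q x e) (q x (\<lambda>_. e m)) = q x (\<lambda>k. if k = m then e m else e k)"
    using assms by (intro t_diag e_closed)
  also have "\<dots> = q x e"
    by (rule arg_cong[of _ _ "q x"]) auto
  finally show ?thesis using assms by (simp add: B1 B4 e_closed)
qed

lemma t_self_snd:
  assumes "x \<in> A" "y \<in> A"
  shows "t m x y x = t m x y (e m)"
  using t_diag_snd[of x x "e m" y m] assms by (simp add: t_self e_closed)

section \<open>Coordinates\<close>

lemma coord_closed:
  assumes "x \<in> A"
  shows "coord i j k x \<in> A"
  unfolding coord_def using assms by (simp add: t_closed e_closed)

text \<open>The \<open>m\<close>-th coordinate is \<open>e j\<close> exactly where \<open>x\<close>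
  is \<open>m\<close>, so testing it against \<open>j\<close> overwrites entry \<open>m\<close>.
  Hence a tuple under \<open>q x\<close> can be changed one entry at a time through the coordinates
  of \<open>x\<close>.\<close>

lemma q_insert_coord:
  assumes "i \<noteq> j" "x \<in> A" "\<And>k. u k \<in> A" "v \<in> A"
  shows "q x (u(m := v)) = t j (coord i j m x) (q x u) v"
proof -
  have "t j (coord i j m x) (q x u) v = t m x (q x u) v"
    unfolding coord_def using assms by (simp add: t_t t_e e_closed q_closed)
  also have "\<dots> = t m x (q x u) (q x (\<lambda>_. v))"
    using assms by (simp add: B1)
  also have "\<dots> = q x (\<lambda>k. if k = m then v else u k)"
    using assms by (intro t_diag)
  also have "\<dots> = q x (u(m := v))"
    by (rule arg_cong[of _ _ "q x"]) auto
  finally show ?thesis ..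
qed

section \<open>Complement and symmetric difference\<close>

lemma neg_closed: "x \<in> A \<Longrightarrow> neg i j x \<in> A"
  by (simp add: neg_def t_closed e_closed)

lemma symdiff_eq:
  assumes "i \<noteq> j" "x \<in> A" "y \<in> A"
  shows "symdiff i j x y = t i x (neg i j y) y"
proof -
  let ?ny = "neg i j y"
  let ?M = "t i x ?ny (e i)" and ?N = "t i x (e i) y"
  have cl: "?ny \<in> A" "?M \<in> A" "?N \<in> A"
    using assms by (simp_all add: t_closed e_closed neg_closed)
  have "meet i (neg i j x) y = ?N"
    unfolding meet_def neg_def using assms by (simp add: t_t t_e e_closed)
  then have "symdiff i j x y = t i ?M ?M ?N"
    by (simp add: symdiff_def join_def meet_def)
  also have "\<dots> = t i x (t i ?ny ?M ?N) ?N"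
    using assms cl by (simp add: t_t t_e e_closed)
  \<comment> \<open>The complement is \<open>e i\<close> exactly where \<open>y\<close> is not, so
    it swaps the two branches.\<close>
  also have "t i ?ny ?M ?N = t i y ?N ?M"
    using assms cl unfolding neg_def by (simp add: t_t t_e e_closed)
  also have "t i x (t i y ?N ?M) ?N = t i x (t i y ?N ?M) y"
    using assms cl by (simp add: t_diag_snd t_closed e_closed)
  also have "t i y ?N ?M = t i x (t i y (e i) ?ny) (t i y y (e i))"
  proof -
    \<comment> \<open>A matrix with rows chosen by \<open>y\<close> and columns by \<open>x\<close>;
      \<open>B3\<close> exchanges the two choices, bringing \<open>x\<close> outside, where it
      merges with the outer \<open>t i x\<close>.\<close>
    have "t i y ?N ?M = q y (\<lambda>k. q x (\<lambda>l. if k = i then if l = i then e i else ?ny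
                                       else if l = i then y else e i))"
      unfolding t_def[of i y] by (rule arg_cong[of _ _ "q y"]) (auto simp: t_def)
    also have "\<dots> = q (q y (\<lambda>_. x)) (\<lambda>l. q y (\<lambda>k. if k = i then if l = i then e i else ?ny
                                       else if l = i then y else e i))"
      using assms cl by (intro B3) (auto simp: e_closed)
    also have "q y (\<lambda>_. x) = x"
      using assms by (simp add: B1)
    also have "q x (\<lambda>l. q y (\<lambda>k. if k = i then if l = i then e i else ?ny
                                       else if l = i then y else e i))
        = t i x (t i y (e i) ?ny) (t i y y (e i))"
      unfolding t_def by (rule arg_cong[of _ _ "q x"]) auto
    finally show ?thesis .
  qed
  also have "t i x \<dots> y = t i x (t i y (e i) ?ny) y"
    using assms cl by (intro t_diag_fst) (auto simp: t_closed e_closed)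
  also have "t i y (e i) ?ny = ?ny"
    unfolding neg_def using assms by (simp add: t_diag_snd e_closed)
  finally show ?thesis .
qed

lemma symdiff_closed:
  assumes "i \<noteq> j" "x \<in> A" "y \<in> A"
  shows "symdiff i j x y \<in> A"
  using assms by (simp add: symdiff_eq t_closed neg_closed)

lemma symdiff_e_left: "i \<noteq> j \<Longrightarrow> y \<in> A \<Longrightarrow> symdiff i j (e i) y = y"
  by (simp add: symdiff_eq e_closed t_e neg_closed)

lemma symdiff_e_right: "i \<noteq> j \<Longrightarrow> x \<in> A \<Longrightarrow> symdiff i j x (e j) = neg i j x"
  by (simp add: symdiff_eq e_closed t_e neg_def)

lemma symdiff_self:
  assumes "i \<noteq> j" "x \<in> A"
  shows "symdiff i j x x = e i"
proof -
  have "symdiff i j x x = t i x (t i x (e i) (e j)) (e i)"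
    using assms by (simp add: symdiff_eq neg_def t_self_snd t_closed e_closed)
  also have "\<dots> = e i"
    using assms by (simp add: t_diag_fst t_const e_closed)
  finally show ?thesis .
qed

text \<open>In the form given by \<open>symdiff_eq\<close> the first argument occurs only as the
  selector, so a \<open>q\<close> there can be pulled out.\<close>

lemma symdiff_q:
  assumes "i \<noteq> j" "x \<in> A" "\<And>k. w k \<in> A" "y \<in> A"
  shows "symdiff i j (q x w) y = q x (\<lambda>k. symdiff i j (w k) y)"
  using assms by (simp add: symdiff_eq t_q neg_closed q_closed)

section \<open>The Boolean center\<close>

lemma B_iff: "i \<noteq> j \<Longrightarrow> x \<in> B i j \<longleftrightarrow> x \<in> A \<and> t i x (e j) (e i) = x"
  by (auto simp: B_def leq_def meet_def t_e e_closed)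

lemma B_subset: "x \<in> B i j \<Longrightarrow> x \<in> A"
  by (simp add: B_def)

lemma e_in_B: "i \<noteq> j \<Longrightarrow> e i \<in> B i j" "i \<noteq> j \<Longrightarrow> e j \<in> B i j"
  by (auto simp: B_iff e_closed t_e)

text \<open>By \<open>B_iff\<close> the center consists of the fixed points of the map that keeps
  the value \<open>i\<close> and sends all others to \<open>j\<close>; this map commutes with
  \<open>q x\<close> by \<open>t_q\<close>, for any \<open>x\<close> in \<open>A\<close>.\<close>

lemma q_in_B:
  assumes "i \<noteq> j" "x \<in> A" "\<And>k. w k \<in> B i j"
  shows "q x w \<in> B i j"
proof -
  have "w k \<in> A" "t i (w k) (e j) (e i) = w k" for k
    using assms(3)[of k] assms(1) by (auto simp: B_iff)
  then show ?thesis
    using assms(1,2) by (simp add: B_iff q_closed t_q e_closed)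
qed

lemma t_in_B:
  assumes "i \<noteq> j" "x \<in> A" "y \<in> B i j" "z \<in> B i j"
  shows "t k x y z \<in> B i j"
  unfolding t_def using assms by (intro q_in_B) auto

lemma coord_in_B: "i \<noteq> j \<Longrightarrow> x \<in> A \<Longrightarrow> coord i j k x \<in> B i j"
  unfolding coord_def by (intro t_in_B e_in_B)

lemma symdiff_in_B:
  assumes "i \<noteq> j" "x \<in> B i j" "y \<in> B i j"
  shows "symdiff i j x y \<in> B i j"
proof -
  have "neg i j y \<in> B i j"
    unfolding neg_def using assms by (intro t_in_B e_in_B B_subset)
  then show ?thesis
    using assms by (simp add: symdiff_eq t_in_B B_subset)
qed

text \<open>Adding \<open>y\<close> to both branches of \<open>x + y\<close> turns them into
  \<open>e j\<close> and \<open>e i\<close>, which rebuilds \<open>x\<close> because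
  \<open>x\<close> lies in the center.\<close>

lemma symdiff_cancel:
  assumes "i \<noteq> j" "x \<in> B i j" "y \<in> B i j"
  shows "symdiff i j (symdiff i j x y) y = x"
proof -
  have A: "x \<in> A" "y \<in> A" "neg i j y \<in> A"
    using assms by (simp_all add: B_subset neg_closed)
  have fst: "t i (neg i j y) (neg i j y) y = e j"
  proof -
    have "t i (neg i j y) (neg i j y) y = t i y y (e j)"
      using assms A unfolding neg_def
      by (simp add: t_t t_e e_closed t_closed t_diag_snd)
    \<comment> \<open>Membership of \<open>y\<close> in the center enters here: where
      \<open>y\<close> is not \<open>i\<close> it is \<open>j\<close>.\<close>
    also have "\<dots> = t i y (t i y (e j) (e i)) (e j)"
      using assms by (simp add: B_iff)
    also have "\<dots> = e j"
      using A by (simp add: t_diag_fst t_const e_closed)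
    finally show ?thesis .
  qed
  have snd: "t i y (neg i j y) y = e i"
    using symdiff_self[of i j y] assms A by (simp add: symdiff_eq)
  have "symdiff i j (symdiff i j x y) y = t i (t i x (neg i j y) y) (neg i j y) y"
    using assms A by (simp add: symdiff_eq t_closed)
  also have "\<dots> = t i x (e j) (e i)"
    using A by (simp add: t_t fst snd)
  also have "\<dots> = x"
    using assms by (simp add: B_iff)
  finally show ?thesis .
qed

section \<open>Congruences\<close>

lemma congruence_subset: "congruence \<phi> \<Longrightarrow> (x, y) \<in> \<phi> \<Longrightarrow> x \<in> A \<and> y \<in> A"
  unfolding congruence_def equiv_def by auto

lemma congruence_refl: "congruence \<phi> \<Longrightarrow> x \<in> A \<Longrightarrow> (x, x) \<in> \<phi>"
  unfolding congruence_def equiv_def refl_on_def by auto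

lemma congruence_sym: "congruence \<phi> \<Longrightarrow> (x, y) \<in> \<phi> \<Longrightarrow> (y, x) \<in> \<phi>"
  unfolding congruence_def equiv_def by (auto dest: symD)

lemma congruence_trans:
  "congruence \<phi> \<Longrightarrow> (x, y) \<in> \<phi> \<Longrightarrow> (y, z) \<in> \<phi> \<Longrightarrow> (x, z) \<in> \<phi>"
  unfolding congruence_def equiv_def by (auto dest: transD)

lemma congruence_t:
  assumes "congruence \<phi>" "(x, x') \<in> \<phi>" "(y, y') \<in> \<phi>" "(z, z') \<in> \<phi>"
  shows "(t k x y z, t k x' y' z') \<in> \<phi>"
proof -
  have cong: "(q x w, q x' w') \<in> \<phi>" if "\<And>m. (w m, w' m) \<in> \<phi>" for w w'
    using assms(1,2) that unfolding congruence_def by simp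
  show ?thesis
    unfolding t_def using assms by (intro cong) auto
qed

lemma congruence_symdiff:
  assumes "congruence \<phi>" "i \<noteq> j" "(x, x') \<in> \<phi>" "y \<in> A"
  shows "(symdiff i j x y, symdiff i j x' y) \<in> \<phi>"
proof -
  have "x \<in> A" "x' \<in> A"
    using congruence_subset assms by auto
  then show ?thesis
    using assms by (simp add: symdiff_eq congruence_t congruence_refl neg_closed)
qed

lemma congruence_coords:
  assumes "congruence \<phi>" "i \<noteq> j" "x \<in> A" "y \<in> A"
    and "\<And>k. (coord i j k x, coord i j k y) \<in> \<phi>"
  shows "(x, y) \<in> \<phi>"
proof -
  \<comment> \<open>Start from the constant tuple \<open>e i\<close>, where \<open>B1\<close> gives
    \<open>e i\<close> on both sides, and insert the entries \<open>e k\<close> one by one with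
    \<open>q_insert_coord\<close>. At \<open>S = UNIV\<close> the tuple is \<open>e\<close>, and
    \<open>B4\<close> returns \<open>x\<close> and \<open>y\<close>.\<close>
  have "(q x (\<lambda>k. if k \<in> S then e k else e i), q y (\<lambda>k. if k \<in> S then e k else e i)) \<in> \<phi>"
    if "finite S" for S
    using that
  proof (induction S rule: finite_induct)
    case empty
    then show ?case using assms by (simp add: B1 e_closed congruence_refl)
  next
    case (insert m S)
    have upd: "(\<lambda>k. if k \<in> insert m S then e k else e i)
        = (\<lambda>k. if k \<in> S then e k else e i)(m := e m)"
      by auto
    show ?case
      unfolding upd using assms insert.IH
      by (subst (1 2) q_insert_coord[of i j])
         (auto intro!: congruence_t congruence_refl simp: e_closed)
  qed
  from this[of UNIV] show ?thesis
    using assms by (simp add: B4)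
qed

lemma theta_cong_multideal:
  assumes c: "congruence \<phi>" and ij: "i \<noteq> j"
  shows "theta i j (cong_multideal \<phi>) = \<phi>"
proof (intro set_eqI iffI; clarify)
  fix x y assume "(x, y) \<in> theta i j (cong_multideal \<phi>)"
  then have A: "x \<in> A" "y \<in> A"
    and eq: "\<And>k. quot_hom i j (cong_multideal \<phi>) (coord i j k x)
              = quot_hom i j (cong_multideal \<phi>) (coord i j k y)"
    by (auto simp: theta_def)
  show "(x, y) \<in> \<phi>"
  proof (rule congruence_coords[OF c ij A])
    fix k
    let ?x = "coord i j k x" and ?y = "coord i j k y"
    have xy: "?x \<in> B i j" "?y \<in> B i j"
      using A ij by (simp_all add: coord_in_B)
    \<comment> \<open>Equal classes are exploited through one member: \<open>?y\<close> lies in its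
      own class since \<open>?y + ?y = e i\<close>, hence in that of \<open>?x\<close>.\<close>
    have "?y \<in> quot_hom i j (cong_multideal \<phi>) ?y"
      using xy ij c
      by (simp add: quot_hom_def bideal_rel_def bideal_def cong_multideal_def symdiff_self
          B_subset e_in_B e_closed congruence_refl)
    then have "?y \<in> quot_hom i j (cong_multideal \<phi>) ?x"
      using eq by simp
    then have "(e i, symdiff i j ?x ?y) \<in> \<phi>"
      by (simp add: quot_hom_def bideal_rel_def bideal_def cong_multideal_def)
    then have "(symdiff i j (symdiff i j ?x ?y) ?y, symdiff i j (e i) ?y) \<in> \<phi>"
      using c ij xy by (intro congruence_symdiff) (auto intro: congruence_sym B_subset)
    then show "(?x, ?y) \<in> \<phi>"
      using ij xy by (simp add: symdiff_cancel symdiff_e_left B_subset)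
  qed
next
  fix x y assume xy: "(x, y) \<in> \<phi>"
  then have A: "x \<in> A" "y \<in> A"
    using congruence_subset c by auto
  \<comment> \<open>The two classes are compared element by element, so no equivalence property of
    \<open>bideal_rel\<close> is invoked.\<close>
  have "symdiff i j (coord i j k x) z \<in> cong_multideal \<phi> i
      \<longleftrightarrow> symdiff i j (coord i j k y) z \<in> cong_multideal \<phi> i" if "z \<in> B i j" for k z
  proof -
    have "(coord i j k x, coord i j k y) \<in> \<phi>"
      unfolding coord_def using c xy by (intro congruence_t congruence_refl e_closed)
    then have "(symdiff i j (coord i j k x) z, symdiff i j (coord i j k y) z) \<in> \<phi>"
      using c ij that by (intro congruence_symdiff B_subset)
    then show ?thesis
      unfolding cong_multideal_def using c
      by (auto intro: congruence_trans congruence_sym)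
  qed
  then show "(x, y) \<in> theta i j (cong_multideal \<phi>)"
    using A ij
    by (auto simp: theta_def quot_hom_def bideal_rel_def bideal_def coord_in_B symdiff_in_B)
qed

section \<open>Multideals\<close>

lemma multideal_subset: "multideal H \<Longrightarrow> x \<in> H k \<Longrightarrow> x \<in> A"
  unfolding multideal_def proper_multideal_def by auto

lemma multideal_e: "multideal H \<Longrightarrow> e k \<in> H k"
  unfolding multideal_def proper_multideal_def by (auto simp: e_closed)

lemma multideal_q:
  assumes "multideal H" "a \<in> H r" "\<And>m. y m \<in> A" "y r \<in> H k"
  shows "q a y \<in> H k"
proof (cases "proper_multideal H")
  case True
  then have "q a (y(r := y r)) \<in> H k"
    using assms unfolding proper_multideal_def by blast
  then show ?thesis by simp
next
  case False
  then have "H = (\<lambda>_. A)"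
    using assms(1) by (simp add: multideal_def)
  then show ?thesis using assms by (simp add: q_closed)
qed

lemma multideal_t:
  assumes "multideal H" "a \<in> H r" "y \<in> A" "z \<in> A" "(if r = m then z else y) \<in> H k"
  shows "t m a y z \<in> H k"
  unfolding t_def using assms by (intro multideal_q[where r = r]) auto

text \<open>As far as membership in the components of \<open>H\<close> is concerned, an element of
  \<open>H k\<close> selects like \<open>e k\<close>.\<close>

lemma multideal_q_iff:
  fixes i j :: 'n
  assumes H: "multideal H" and ij: "i \<noteq> j" and a: "a \<in> H k" and s: "\<And>m. s m \<in> A"
  shows "q a s \<in> H r \<longleftrightarrow> s k \<in> H r"
proof
  assume qs: "q a s \<in> H r"
  have A: "a \<in> A"
    using multideal_subset H a .
  \<comment> \<open>\<open>b\<close> is \<open>e i\<close> where \<open>a\<close> is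
    \<open>k\<close> and \<open>e j\<close> elsewhere. Selecting with it between
    \<open>q a s\<close> and \<open>s k\<close> gives \<open>s k\<close> everywhere, since
    \<open>q a s\<close> already equals \<open>s k\<close> where \<open>a\<close> is
    \<open>k\<close>.\<close>
  define b where "b = t k a (e j) (e i)"
  have b: "b \<in> H i"
    unfolding b_def using H a by (intro multideal_t[where r = k]) (auto simp: e_closed multideal_e)
  have "t i b (s k) (q a s) = t k a (s k) (q a s)"
    unfolding b_def using A ij s by (simp add: t_t t_e e_closed q_closed)
  also have "\<dots> = t k a (q a (\<lambda>_. s k)) (q a s)"
    using A s by (simp add: B1)
  also have "\<dots> = q a (\<lambda>m. if m = k then s m else s k)"
    using A s by (intro t_diag)
  also have "\<dots> = q a (\<lambda>_. s k)"
    by (rule arg_cong[of _ _ "q a"]) auto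
  finally have "t i b (s k) (q a s) = s k"
    using A s by (simp add: B1)
  moreover have "t i b (s k) (q a s) \<in> H r"
    using H b s A qs by (intro multideal_t[where r = i]) (auto simp: q_closed)
  ultimately show "s k \<in> H r" by simp
next
  assume "s k \<in> H r"
  then show "q a s \<in> H r"
    using H a s by (intro multideal_q[where r = k])
qed

lemma cong_multideal_theta:
  assumes H: "multideal H" and ij: "i \<noteq> j"
  shows "cong_multideal (theta i j H) = H"
proof (intro ext set_eqI iffI)
  fix k a assume "a \<in> cong_multideal (theta i j H) k"
  then have A: "a \<in> A"
    and "quot_hom i j H (coord i j k (e k)) = quot_hom i j H (coord i j k a)"
    by (auto simp: cong_multideal_def theta_def)
  moreover have "coord i j k (e k) = e j"
    by (simp add: coord_def t_e e_closed)
  moreover have "e j \<in> quot_hom i j H (e j)"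
    using ij H by (simp add: quot_hom_def bideal_rel_def bideal_def symdiff_self e_in_B
        e_closed multideal_e)
  ultimately have "e j \<in> quot_hom i j H (coord i j k a)"
    by simp
  then have "neg i j (coord i j k a) \<in> H i"
    using ij A
    by (simp add: quot_hom_def bideal_rel_def bideal_def symdiff_e_right coord_closed)
  \<comment> \<open>The complement of the \<open>k\<close>-th coordinate is the element called
    \<open>b\<close> in \<open>multideal_q_iff\<close>.\<close>
  moreover have "neg i j (coord i j k a) = t k a (e j) (e i)"
    unfolding neg_def coord_def using ij A by (simp add: t_t t_e e_closed)
  ultimately have b: "t k a (e j) (e i) \<in> H i"
    by simp
  \<comment> \<open>Where \<open>a\<close> is \<open>k\<close> it agrees with \<open>e k\<close>, so
    the selection changes nothing; as the selector is in \<open>H i\<close>, the result falls into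
    the component of \<open>e k\<close>.\<close>
  have "t i (t k a (e j) (e i)) a (e k) = a"
    using ij A by (simp add: t_t t_e e_closed t_self)
  moreover have "t i (t k a (e j) (e i)) a (e k) \<in> H k"
    using H A by (intro multideal_t[OF H b]) (auto simp: e_closed multideal_e)
  ultimately show "a \<in> H k" by simp
next
  fix k a assume a: "a \<in> H k"
  then have A: "a \<in> A"
    using multideal_subset H by blast
  have "symdiff i j (coord i j m (e k)) z \<in> H i \<longleftrightarrow> symdiff i j (coord i j m a) z \<in> H i"
    if "z \<in> B i j" for m z
  proof -
    \<comment> \<open>\<open>w\<close> is the tuple defining the \<open>m\<close>-th coordinate, so
      that of \<open>e k\<close> is \<open>w k\<close>. Moving \<open>symdiff\<close> inside
      \<open>q a\<close> lets \<open>multideal_q_iff\<close> replace \<open>a\<close> by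
      \<open>e k\<close>.\<close>
    define w where "w l = (if l = m then e j else e i)" for l
    have w: "w l \<in> A" for l
      by (simp add: w_def e_closed)
    have z: "z \<in> A"
      using that by (rule B_subset)
    have "symdiff i j (coord i j m a) z = q a (\<lambda>l. symdiff i j (w l) z)"
      unfolding coord_def t_def w_def[symmetric] using ij A w z by (rule symdiff_q)
    moreover have "q a (\<lambda>l. symdiff i j (w l) z) \<in> H i \<longleftrightarrow> symdiff i j (w k) z \<in> H i"
      using H ij a w z by (intro multideal_q_iff[where s = "\<lambda>l. symdiff i j (w l) z"] symdiff_closed)
    moreover have "coord i j m (e k) = w k"
      by (simp add: coord_def t_e e_closed w_def)
    ultimately show ?thesis by simp
  qed
  then show "a \<in> cong_multideal (theta i j H) k"
    using A ij
    by (auto simp: cong_multideal_def theta_def quot_hom_def bideal_rel_def bideal_def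
        coord_in_B symdiff_in_B e_closed)
qed

end

theorem theorem7p9:
  fixes A :: "'a set"
    and q :: "'a \<Rightarrow> ('n::finite \<Rightarrow> 'a) \<Rightarrow> 'a"
    and e :: "'n \<Rightarrow> 'a"
    and i j :: 'n
    and \<phi> :: "('a \<times> 'a) set"
    and H :: "'n \<Rightarrow> 'a set"
  assumes "nBA A q e"
    and "i \<noteq> j"
    and "nBA.congruence A q \<phi>"
    and "nBA.multideal A q e H"
  shows "nBA.theta A q e i j (nBA.cong_multideal e \<phi>) = \<phi>
       \<and> nBA.cong_multideal e (nBA.theta A q e i j H) = H"
  using nBA.theta_cong_multideal[OF assms(1,3,2)] nBA.cong_multideal_theta[OF assms(1,4,2)] by (rule conjI)

end
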